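(* Let $X$ be a real Banach space. Then $X$ is a Gelfand-Phillips space if and only if Gâteaux differentiability (equivalently, Hadamard differentiability) and limited differentiability coincide for real-valued Lipschitz functions on $X$; that is, if and only if for every Lipschitz function $f:X\to\mathbb{R}$ and every $x\in X$, $f$ is Gâteaux differentiable at $x$ exactly when $f$ is limited differentiable at $x$.
   Context: A bounded set $A\subset X$ is limited if for every weak$^*$-null sequence $(x_n^* )_n\subset X^*$ one has $\lim_{n}\sup_{x\in A}|\langle x_n^*,x\rangle|=0$. $X$ is a Gelfand-Phillips space if all limited sets in $X$ are relatively norm-compact. For a family $\beta$ of bounded nonempty subsets of $X$, a function $f:X\to\mathbb{R}$ is $\beta$-differentiable at $x_0\in X$ if there is a bounded linear functional $d_\beta f(x_0):X\to\mathbb{R}$ such that $\lim_{t\to 0}\sup_{u\in A}\left|\frac{f(x_0+tu)-f(x_0)}{t}-d_\beta f(x_0)(u)\right|=0$ for every $A\in\beta$. Gâteaux, Hadamard and limited differentiability are $\beta$-differentiability for $\beta$ the family of all nonempty finite sets, of all nonempty relatively norm-compact sets, and of all nonempty limited sets, respectively. For real-valued Lipschitz functions, Gâteaux and Hadamard differentiability at a point coincide. *)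

theory Defs
  imports "HOL-Analysis.Analysis"
begin

text \<open>The Banach space \<open>X\<close> is the type \<^typ>\<open>'a::banach\<close>, and its dual is \<^typ>\<open>'a \<Rightarrow>\<^sub>L real\<close>.
  Suprema are taken in \<^typ>\<open>ennreal\<close>: the supremum of an unbounded family is then \<open>\<infinity>\<close>
  (which matters for difference quotients of arbitrary functions) and that of the empty family
  is \<open>0\<close>, whereas the supremum in \<^typ>\<open>real\<close> is unspecified in both cases.\<close>

definition weak_star_null :: "(nat \<Rightarrow> ('a::real_normed_vector \<Rightarrow>\<^sub>L real)) \<Rightarrow> bool" where
  "weak_star_null \<xi> \<longleftrightarrow> (\<forall>x. (\<lambda>n. blinfun_apply (\<xi> n) x) \<longlonglongrightarrow> 0)"

definition limited_set :: "'a::real_normed_vector set \<Rightarrow> bool" where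
  "limited_set A \<longleftrightarrow> bounded A \<and>
     (\<forall>\<xi> :: nat \<Rightarrow> ('a \<Rightarrow>\<^sub>L real). weak_star_null \<xi> \<longrightarrow>
        (\<lambda>n. SUP x\<in>A. ennreal \<bar>blinfun_apply (\<xi> n) x\<bar>) \<longlonglongrightarrow> 0)"

definition gelfand_phillips :: "'a::banach itself \<Rightarrow> bool" where
  "gelfand_phillips X \<longleftrightarrow> (\<forall>A :: 'a set. limited_set A \<longrightarrow> compact (closure A))"

definition beta_differentiable ::
  "'a::real_normed_vector set set \<Rightarrow> ('a \<Rightarrow> real) \<Rightarrow> 'a \<Rightarrow> bool" where
  "beta_differentiable \<beta> f x \<longleftrightarrow> (\<exists>d :: 'a \<Rightarrow>\<^sub>L real. \<forall>A\<in>\<beta>.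
     ((\<lambda>t. SUP u\<in>A. ennreal \<bar>(f (x + t *\<^sub>R u) - f x) / t - blinfun_apply d u\<bar>) \<longlongrightarrow> 0) (at (0::real)))"

definition gateaux_differentiable :: "('a::real_normed_vector \<Rightarrow> real) \<Rightarrow> 'a \<Rightarrow> bool" where
  "gateaux_differentiable = beta_differentiable {A. A \<noteq> {} \<and> finite A}"

definition hadamard_differentiable :: "('a::real_normed_vector \<Rightarrow> real) \<Rightarrow> 'a \<Rightarrow> bool" where
  "hadamard_differentiable = beta_differentiable {A. A \<noteq> {} \<and> compact (closure A)}"

definition limited_differentiable :: "('a::real_normed_vector \<Rightarrow> real) \<Rightarrow> 'a \<Rightarrow> bool" where
  "limited_differentiable = beta_differentiable {A. A \<noteq> {} \<and> limited_set A}"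

end

theory Submission
  imports Defs
begin

text \<open>A Lipschitz function has equi-Lipschitz difference quotients, so at a point of Gateaux
  differentiability they converge uniformly on totally bounded sets; in a Gelfand-Phillips space
  these include the limited sets. Conversely, a limited set that is not relatively compact contains
  a bounded sequence \<open>a\<^sub>n\<close> that is \<open>e\<close>-separated, also from \<open>0\<close>. Let \<open>f\<close> be the distance to the
  complement of the union of the balls of radius \<open>e / (4 (n + 1))\<close> around \<open>a\<^sub>n / (n + 1)\<close>.
  Each line through \<open>0\<close> meets only finitely many of these balls, so the Gateaux derivative
  of \<open>f\<close> at \<open>0\<close> is \<open>0\<close>, while \<open>f\<close> takes a value \<open>\<ge> e / (4 (n + 1))\<close> at \<open>a\<^sub>n / (n + 1)\<close>.\<close>

section \<open>Differentiability as uniform convergence of difference quotients\<close>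

lemma SUP_abs_tendsto_0_iff_uniform_limit:
  fixes g :: "'b \<Rightarrow> 'c \<Rightarrow> real"
  shows "((\<lambda>t. SUP u\<in>A. ennreal \<bar>g t u - h u\<bar>) \<longlongrightarrow> 0) F \<longleftrightarrow> uniform_limit A g h F"
proof
  assume lim: "((\<lambda>t. SUP u\<in>A. ennreal \<bar>g t u - h u\<bar>) \<longlongrightarrow> 0) F"
  show "uniform_limit A g h F"
  proof (rule uniform_limitI)
    fix e :: real assume "e > 0"
    then have "\<forall>\<^sub>F t in F. (SUP u\<in>A. ennreal \<bar>g t u - h u\<bar>) < ennreal e"
      using lim by (intro order_tendstoD(2)) auto
    then show "\<forall>\<^sub>F t in F. \<forall>u\<in>A. dist (g t u) (h u) < e"
    proof eventually_elim
      case (elim t)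
      show ?case
      proof
        fix u assume "u \<in> A"
        then have "ennreal \<bar>g t u - h u\<bar> < ennreal e"
          by (intro le_less_trans[OF _ elim] SUP_upper)
        then show "dist (g t u) (h u) < e"
          by (simp add: dist_real_def ennreal_less_iff)
      qed
    qed
  qed
next
  assume unif: "uniform_limit A g h F"
  show "((\<lambda>t. SUP u\<in>A. ennreal \<bar>g t u - h u\<bar>) \<longlongrightarrow> 0) F"
  proof (rule order_tendstoI)
    fix c :: ennreal assume "0 < c"
    \<comment> \<open>Pointwise bounds pass to the supremum only as a weak inequality, so an
      intermediate \<open>b\<close> restores the strict one. Lying below \<open>c\<close>, it is
      finite and hence comes from a positive real.\<close>
    then obtain b where b: "0 < b" "b < c"
      using dense by blast
    then obtain e where e: "b = ennreal e" "e > 0"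
      by (cases b) (auto simp: ennreal_zero_less_top)
    have "\<forall>\<^sub>F t in F. \<forall>u\<in>A. dist (g t u) (h u) < e"
      using uniform_limitD[OF unif \<open>e > 0\<close>] .
    then show "\<forall>\<^sub>F t in F. (SUP u\<in>A. ennreal \<bar>g t u - h u\<bar>) < c"
    proof eventually_elim
      case (elim t)
      then have "(SUP u\<in>A. ennreal \<bar>g t u - h u\<bar>) \<le> b"
        unfolding e by (intro SUP_least ennreal_leI) (auto simp: dist_real_def less_imp_le)
      then show ?case
        using b by simp
    qed
  qed simp
qed

lemma uniform_limit_finite_iff:
  assumes "finite A"
  shows "uniform_limit A f g F \<longleftrightarrow> (\<forall>x\<in>A. ((\<lambda>n. f n x) \<longlongrightarrow> g x) F)"
proof
  assume "uniform_limit A f g F"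
  then show "\<forall>x\<in>A. ((\<lambda>n. f n x) \<longlongrightarrow> g x) F"
    by (simp add: tendsto_uniform_limitI)
next
  assume "\<forall>x\<in>A. ((\<lambda>n. f n x) \<longlongrightarrow> g x) F"
  then show "uniform_limit A f g F"
    using assms uniform_limit_on_UNION[where S = A and h = "\<lambda>x. {x}" and f = f and g = g and F = F] by simp
qed

lemma beta_differentiable_iff_uniform_limit:
  "beta_differentiable \<beta> f x \<longleftrightarrow> (\<exists>d :: 'a::real_normed_vector \<Rightarrow>\<^sub>L real. \<forall>A\<in>\<beta>.
     uniform_limit A (\<lambda>t u. (f (x + t *\<^sub>R u) - f x) / t) (blinfun_apply d) (at 0))"
  unfolding beta_differentiable_def by (simp only: SUP_abs_tendsto_0_iff_uniform_limit)

lemma beta_differentiable_mono: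
  assumes "beta_differentiable \<beta> f x" "\<gamma> \<subseteq> \<beta>"
  shows "beta_differentiable \<gamma> f x"
  using assms unfolding beta_differentiable_def by blast

section \<open>Comparison of the three notions of differentiability\<close>

lemma limited_set_finite:
  assumes "finite A"
  shows "limited_set A"
proof -
  have "(\<lambda>n. SUP x\<in>A. ennreal \<bar>blinfun_apply (\<xi> n) x\<bar>) \<longlonglongrightarrow> 0"
    if "weak_star_null \<xi>" for \<xi> :: "nat \<Rightarrow> ('a \<Rightarrow>\<^sub>L real)"
    using SUP_abs_tendsto_0_iff_uniform_limit[of "\<lambda>n. blinfun_apply (\<xi> n)" "\<lambda>_. 0" A sequentially]
      that assms by (simp add: uniform_limit_finite_iff weak_star_null_def)
  then show ?thesis
    using assms by (simp add: limited_set_def finite_imp_bounded)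
qed

lemma limited_imp_gateaux_differentiable:
  "limited_differentiable f x \<Longrightarrow> gateaux_differentiable f x"
  unfolding limited_differentiable_def gateaux_differentiable_def
  by (erule beta_differentiable_mono) (auto intro: limited_set_finite)

lemma hadamard_imp_gateaux_differentiable:
  "hadamard_differentiable f x \<Longrightarrow> gateaux_differentiable f x"
  unfolding hadamard_differentiable_def gateaux_differentiable_def
  by (erule beta_differentiable_mono)
    (auto simp: finite_imp_compact finite_imp_closed)

lemma gateaux_imp_hadamard_differentiable:
  fixes f :: "'a::real_normed_vector \<Rightarrow> real"
  assumes lip: "L-lipschitz_on UNIV f" and gat: "gateaux_differentiable f x"
  shows "hadamard_differentiable f x"
proof -
  let ?q = "\<lambda>t u. (f (x + t *\<^sub>R u) - f x) / t"
  obtain d :: "'a \<Rightarrow>\<^sub>L real"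
    where d: "\<And>A. A \<noteq> {} \<Longrightarrow> finite A \<Longrightarrow> uniform_limit A ?q d (at 0)"
    using gat unfolding gateaux_differentiable_def beta_differentiable_iff_uniform_limit by blast
  \<comment> \<open>The factor \<open>\<bar>t\<bar>\<close> from the increment cancels against the
    denominator, so one constant \<open>L\<close> serves all \<open>t\<close>.\<close>
  have q_lip: "dist (?q t u) (?q t v) \<le> L * dist u v" if "t \<noteq> 0" for t u v
  proof -
    have "\<bar>f (x + t *\<^sub>R u) - f (x + t *\<^sub>R v)\<bar> \<le> L * (\<bar>t\<bar> * dist u v)"
      using lipschitz_onD[OF lip, of "x + t *\<^sub>R u" "x + t *\<^sub>R v"]
      by (simp add: dist_norm flip: scaleR_diff_right)
    moreover have "?q t u - ?q t v = (f (x + t *\<^sub>R u) - f (x + t *\<^sub>R v)) / t"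
      by (simp add: diff_divide_distrib)
    ultimately show ?thesis
      using that by (simp add: dist_real_def abs_divide divide_le_eq algebra_simps)
  qed
  have "uniform_limit K ?q d (at 0)" if K: "compact (closure K)" for K
  proof (rule uniform_limitI)
    fix e :: real assume "e > 0"
    \<comment> \<open>Moving from \<open>u\<close> to a centre within \<open>e / M\<close> changes
      the quotient and \<open>d\<close> by at most \<open>e / 2\<close> together; the other half of
      \<open>e\<close> pays for the convergence at the centres. The summand 1 keeps \<open>M\<close>
      positive when \<open>L\<close> and \<open>d\<close> vanish.\<close>
    define M where "M = 2 * (L + norm d + 1)"
    have "M > 0"
      using lipschitz_on_nonneg[OF lip] by (simp add: M_def add_nonneg_pos)
    have "e / M > 0"
      using \<open>e > 0\<close> \<open>M > 0\<close> by simp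
    then obtain k where k: "finite k" "closure K \<subseteq> (\<Union>v\<in>k. ball v (e / M))"
      using K unfolding compact_eq_totally_bounded by blast
    have "uniform_limit k ?q d (at 0)"
      \<comment> \<open>\<open>d\<close> is available on nonempty sets only, whereas the cover of an
        empty \<open>K\<close> may have no centres.\<close>
      using d k(1) by (cases "k = {}") auto
    then have "\<forall>\<^sub>F t in at 0. \<forall>v\<in>k. dist (?q t v) (d v) < e / 2"
      using \<open>e > 0\<close> by (intro uniform_limitD) auto
    moreover have "\<forall>\<^sub>F t in at (0::real). t \<noteq> 0"
      by (simp add: eventually_at_filter)
    ultimately show "\<forall>\<^sub>F t in at 0. \<forall>u\<in>K. dist (?q t u) (d u) < e"
    proof eventually_elim
      case (elim t)
      show ?case
      proof
        fix u assume "u \<in> K"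
        then obtain v where v: "v \<in> k" "dist u v < e / M"
          using k(2) closure_subset[of K] by (auto simp: dist_commute)
        have "dist (d v) (d u) \<le> norm d * dist u v"
          using norm_blinfun[of d "v - u"]
          by (simp add: dist_norm blinfun.diff_right norm_minus_commute)
        moreover have "dist (?q t u) (?q t v) \<le> L * dist u v"
          using elim by (intro q_lip) auto
        moreover have "(L + norm d) * dist u v \<le> e / 2"
        proof -
          have "(L + norm d) * dist u v \<le> (L + norm d + 1) * (e / M)"
            using v lipschitz_on_nonneg[OF lip] by (intro mult_mono) auto
          also have "\<dots> = e / 2"
            using \<open>M > 0\<close> by (simp add: M_def field_simps)
          finally show ?thesis .
        qed
        moreover have "dist (?q t u) (d u)
            \<le> dist (?q t u) (?q t v) + dist (?q t v) (d v) + dist (d v) (d u)"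
          by (rule order_trans[OF dist_triangle[of _ _ "?q t v"]])
            (use dist_triangle[of "?q t v" "d u" "d v"] in linarith)
        moreover have "dist (?q t v) (d v) < e / 2"
          using elim v by blast
        ultimately show "dist (?q t u) (d u) < e"
          by (simp add: distrib_right)
      qed
    qed
  qed
  then show ?thesis
    unfolding hadamard_differentiable_def beta_differentiable_iff_uniform_limit by blast
qed

section \<open>Separated sequences\<close>

lemma not_relatively_compact_imp_separated_sequence:
  fixes A :: "'a::complete_space set"
  assumes "\<not> compact (closure A)"
  obtains e a where "e > 0" "\<And>n::nat. a n \<in> A" "\<And>n. e \<le> dist z (a n)"
    "\<And>i j. i \<noteq> j \<Longrightarrow> e \<le> dist (a i) (a j)"
proof -
  obtain r where r: "r > 0" "\<And>k. finite k \<Longrightarrow> \<not> closure A \<subseteq> (\<Union>x\<in>k. ball x r)"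
    using assms unfolding compact_eq_totally_bounded by (meson closed_closure complete_eq_closed)
  define e where "e = r / 2"
  have "e > 0"
    using r by (simp add: e_def)
  \<comment> \<open>A finite union of closed balls is closed, so a cover of \<open>A\<close> would
    also cover its closure. Halving the radius puts these closed balls inside the open balls of
    radius \<open>r\<close>.\<close>
  have uncovered: "\<not> A \<subseteq> (\<Union>x\<in>k. cball x e)" if "finite k" for k
  proof
    assume "A \<subseteq> (\<Union>x\<in>k. cball x e)"
    then have "closure A \<subseteq> (\<Union>x\<in>k. cball x e)"
      using that by (intro closure_minimal closed_UN) auto
    also have "\<dots> \<subseteq> (\<Union>x\<in>k. ball x r)"
      using r by (force simp: e_def)
    finally show False
      using r that by blast
  qed
  \<comment> \<open>Each new term avoids the closed balls around \<open>z\<close> and all earlier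
    terms; including \<open>z\<close> gives the separation from it as well.\<close>
  let ?P = "\<lambda>(a :: nat \<Rightarrow> 'a) n y. y \<in> A \<and> (\<forall>x\<in>insert z (a ` {..<n}). e \<le> dist x y)"
  have "\<exists>a :: nat \<Rightarrow> 'a. \<forall>n. ?P a n (a n)"
  proof (rule dependent_wellorder_choice)
    fix a :: "nat \<Rightarrow> 'a" and n :: nat
    show "\<exists>y. ?P a n y"
      using uncovered[of "insert z (a ` {..<n})"] by (auto simp: subset_iff not_le less_imp_le)
  qed auto
  then obtain a where a: "\<And>n. ?P a n (a n)"
    by blast
  have "e \<le> dist (a i) (a j)" if "i \<noteq> j" for i j
    using a[of i] a[of j] that by (cases i j rule: linorder_cases) (auto simp: dist_commute)
  with a \<open>e > 0\<close> show thesis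
    by (intro that[of e a]) auto
qed

text \<open>Boundedness of the sequence confines the relevant part of the line to a compact segment,
  covered by finitely many balls of radius \<open>e / 4\<close>. Each centre lies within
  \<open>e / 2\<close> of at most one term, by separation.\<close>

lemma finite_separated_near_line:
  fixes a :: "nat \<Rightarrow> 'a::real_normed_vector"
  assumes "bounded (range a)" "e > 0" and sep: "\<And>i j. i \<noteq> j \<Longrightarrow> e \<le> dist (a i) (a j)"
  shows "finite {n. \<exists>s. dist (a n) (s *\<^sub>R u) < e / 4}"
proof -
  let ?N = "{n. \<exists>s. dist (a n) (s *\<^sub>R u) < e / 4}"
  obtain M where M: "\<And>n. norm (a n) \<le> M"
    using assms(1) by (auto simp: bounded_iff)
  \<comment> \<open>If \<open>s *\<^sub>R u\<close> is close to some \<open>a n\<close>, its norm is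
    at most \<open>M + e\<close>, which bounds \<open>s\<close>. For \<open>u = 0\<close> the
    division yields \<open>B = 0\<close>, and the segment \<open>{0}\<close> is still the whole
    line.\<close>
  define B where "B = (M + e) / norm u"
  have "compact ((\<lambda>s. s *\<^sub>R u) ` {-B..B})"
    by (intro compact_continuous_image continuous_intros) auto
  then obtain k where k: "finite k" "(\<lambda>s. s *\<^sub>R u) ` {-B..B} \<subseteq> (\<Union>x\<in>k. ball x (e / 4))"
    unfolding compact_eq_totally_bounded using \<open>e > 0\<close> by (meson divide_pos_pos zero_less_numeral)
  have "\<exists>x\<in>k. dist (a n) x < e / 2" if n: "n \<in> ?N" for n
  proof -
    obtain s where s: "dist (a n) (s *\<^sub>R u) < e / 4"
      using n by blast
    have "norm (s *\<^sub>R u) \<le> norm (a n) + dist (a n) (s *\<^sub>R u)"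
      by (metis dist_norm norm_minus_commute norm_triangle_sub)
    also have "\<dots> \<le> M + e"
      using M[of n] s \<open>e > 0\<close> by linarith
    finally have "\<bar>s\<bar> * norm u \<le> M + e"
      by simp
    then have "s *\<^sub>R u \<in> (\<lambda>s. s *\<^sub>R u) ` {-B..B}"
    proof (cases "u = 0")
      case False
      with \<open>\<bar>s\<bar> * norm u \<le> M + e\<close> have "\<bar>s\<bar> \<le> B"
        by (simp add: B_def pos_le_divide_eq)
      then show ?thesis
        by (auto simp: abs_le_iff)
    qed (auto simp: B_def)
    then obtain x where "x \<in> k" "dist x (s *\<^sub>R u) < e / 4"
      using k(2) by (meson UN_E mem_ball subsetD)
    moreover have "dist (a n) x \<le> dist (a n) (s *\<^sub>R u) + dist x (s *\<^sub>R u)"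
      by (rule dist_triangle2)
    ultimately show ?thesis
      using s by (intro bexI[of _ x]) linarith+
  qed
  then obtain c where c: "\<And>n. n \<in> ?N \<Longrightarrow> c n \<in> k \<and> dist (a n) (c n) < e / 2"
    using bchoice[of ?N "\<lambda>n x. x \<in> k \<and> dist (a n) x < e / 2"] by blast
  \<comment> \<open>Two terms sharing a centre would be at distance less than
    \<open>e / 2 + e / 2\<close>.\<close>
  have "inj_on c ?N"
  proof (rule inj_onI, rule ccontr)
    fix i j assume "i \<in> ?N" "j \<in> ?N" "c i = c j" "i \<noteq> j"
    then show False
      using c[of i] c[of j] sep[of i j] dist_triangle2[of "a i" "a j" "c i"] by simp
  qed
  moreover have "c ` ?N \<subseteq> k"
    using c by blast
  ultimately show ?thesis
    using k(1) by (meson finite_imageD finite_subset)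
qed

section \<open>A Lipschitz function from a limited set that is not relatively compact\<close>

lemma gateaux_not_limited_differentiable:
  fixes A :: "'a::banach set"
  assumes A: "limited_set A" "\<not> compact (closure A)"
  obtains f :: "'a \<Rightarrow> real" where "1-lipschitz_on UNIV f" "gateaux_differentiable f 0"
    "\<not> limited_differentiable f 0"
proof -
  obtain e a where e: "e > 0" and aA: "\<And>n::nat. a n \<in> A" and a0: "\<And>n. e \<le> dist 0 (a n)"
    and sep: "\<And>i j. i \<noteq> j \<Longrightarrow> e \<le> dist (a i) (a j)"
    using not_relatively_compact_imp_separated_sequence[OF A(2), of 0] by metis
  have "bounded (range a)"
    using A(1) aA unfolding limited_set_def by (meson bounded_subset image_subsetI)
  define t :: "nat \<Rightarrow> real" where "t n = inverse (real (Suc n))" for n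
  have t_pos: "t n > 0" for n
    by (simp add: t_def)
  \<comment> \<open>Scaling the radius along with the centre makes \<open>U n\<close> the
    \<open>t n\<close>-multiple of the ball of radius \<open>e / 4\<close> around
    \<open>a n\<close>. Hence \<open>s *\<^sub>R u\<close> lies in \<open>U n\<close> exactly when
    \<open>(s / t n) *\<^sub>R u\<close> lies in that ball, a condition on the line through
    \<open>u\<close> alone.\<close>
  define U where "U n = ball (t n *\<^sub>R a n) (t n * (e / 4))" for n
  define f :: "'a \<Rightarrow> real" where "f y = infdist y (- (\<Union>n. U n))" for y
  have zero_notin: "0 \<notin> U n" for n
  proof -
    have "t n * (e / 4) \<le> t n * norm (a n)"
      using a0[of n] e t_pos[of n] by (intro mult_left_mono) auto
    then show ?thesis
      using t_pos[of n] by (simp add: U_def)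
  qed
  have f_zero: "f y = 0" if "\<And>n. y \<notin> U n" for y
    using that by (simp add: f_def)
  have f0: "f 0 = 0"
    using zero_notin by (intro f_zero)
  have lip: "1-lipschitz_on UNIV f"
    by (intro lipschitz_onI) (auto simp: f_def dist_real_def infdist_triangle_abs)
  have line: "\<forall>\<^sub>F s in at 0. f (s *\<^sub>R u) = 0" for u
  proof -
    let ?N = "{n. \<exists>s. dist (a n) (s *\<^sub>R u) < e / 4}"
    have "finite ?N"
      using \<open>bounded (range a)\<close> e sep by (rule finite_separated_near_line)
    \<comment> \<open>Only the balls with index in \<open>?N\<close> can meet the line. Each of them
      has positive distance from 0, so it is missed by all sufficiently small multiples of
      \<open>u\<close>.\<close>
    moreover have "\<forall>\<^sub>F s in at 0. s *\<^sub>R u \<notin> U n" if "n \<in> ?N" for n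
    proof -
      have "t n * (e / 4) < t n * norm (a n)"
        using a0[of n] e t_pos[of n] by (intro mult_strict_left_mono) auto
      then have "t n * (e / 4) < dist (t n *\<^sub>R a n) (0 *\<^sub>R u)"
        using t_pos[of n] by simp
      moreover have "((\<lambda>s. dist (t n *\<^sub>R a n) (s *\<^sub>R u)) \<longlongrightarrow> dist (t n *\<^sub>R a n) (0 *\<^sub>R u)) (at 0)"
        by (intro tendsto_intros)
      ultimately have "\<forall>\<^sub>F s in at 0. t n * (e / 4) < dist (t n *\<^sub>R a n) (s *\<^sub>R u)"
        by (rule order_tendstoD(1)[rotated])
      then show ?thesis
        by eventually_elim (simp add: U_def)
    qed
    ultimately have "\<forall>\<^sub>F s in at 0. \<forall>n\<in>?N. s *\<^sub>R u \<notin> U n"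
      by (intro eventually_ball_finite) blast+
    then show ?thesis
    proof eventually_elim
      case (elim s)
      show ?case
      proof (rule f_zero)
        fix n show "s *\<^sub>R u \<notin> U n"
        proof
          assume "s *\<^sub>R u \<in> U n"
          then have "norm (t n *\<^sub>R (a n - (s / t n) *\<^sub>R u)) < t n * (e / 4)"
            using t_pos[of n] by (simp add: U_def dist_norm scaleR_diff_right)
          then have "dist (a n) ((s / t n) *\<^sub>R u) < e / 4"
            using t_pos[of n] by (simp add: dist_norm)
          with elim \<open>s *\<^sub>R u \<in> U n\<close> show False
            by blast
        qed
      qed
    qed
  qed
  have quot: "((\<lambda>s. (f (0 + s *\<^sub>R u) - f 0) / s) \<longlongrightarrow> 0) (at 0)" for u
    by (rule tendsto_eventually) (use line[of u] in \<open>auto simp: f0 elim: eventually_mono\<close>)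
  have "gateaux_differentiable f 0"
    unfolding gateaux_differentiable_def beta_differentiable_iff_uniform_limit
    using quot by (intro exI[of _ 0]) (auto simp: uniform_limit_finite_iff)
  moreover have "\<not> limited_differentiable f 0"
  proof
    assume "limited_differentiable f 0"
    then obtain d :: "'a \<Rightarrow>\<^sub>L real" where d: "\<And>S. S \<noteq> {} \<Longrightarrow> limited_set S \<Longrightarrow>
        uniform_limit S (\<lambda>s u. (f (0 + s *\<^sub>R u) - f 0) / s) d (at 0)"
      unfolding limited_differentiable_def beta_differentiable_iff_uniform_limit by blast
    \<comment> \<open>Singletons are limited, which forces \<open>d\<close> to agree with the
      Gateaux derivative.\<close>
    have d0: "d u = 0" for u
    proof (rule tendsto_unique[OF _ _ quot])
      show "((\<lambda>s. (f (0 + s *\<^sub>R u) - f 0) / s) \<longlongrightarrow> d u) (at 0)"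
        using d[of "{u}"] by (simp add: limited_set_finite)
    qed simp
    have "uniform_limit A (\<lambda>s u. (f (0 + s *\<^sub>R u) - f 0) / s) d (at 0)"
      using aA A(1) by (intro d) auto
    then have "\<forall>\<^sub>F s in at 0. \<forall>u\<in>A. dist ((f (0 + s *\<^sub>R u) - f 0) / s) (d u) < e / 4"
      using e by (intro uniform_limitD) auto
    \<comment> \<open>Uniformity over \<open>A\<close> allows the direction to vary with the step:
      at step \<open>t n\<close> the direction \<open>a n\<close> is tested, where the quotient is
      at least \<open>e / 4\<close>.\<close>
    moreover have "filterlim t (at 0) sequentially"
      using t_pos LIMSEQ_inverse_real_of_nat
      by (auto simp: filterlim_at t_def[abs_def])
    ultimately have "\<forall>\<^sub>F n in sequentially.
        \<forall>u\<in>A. dist ((f (0 + t n *\<^sub>R u) - f 0) / t n) (d u) < e / 4"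
      by (rule eventually_compose_filterlim)
    then obtain n where "\<forall>u\<in>A. dist ((f (0 + t n *\<^sub>R u) - f 0) / t n) (d u) < e / 4"
      using eventually_happens'[OF sequentially_bot] by blast
    then have "dist ((f (0 + t n *\<^sub>R a n) - f 0) / t n) (d (a n)) < e / 4"
      using aA by blast
    then have "f (t n *\<^sub>R a n) / t n < e / 4"
      by (simp only: d0 f0 dist_real_def add_0 diff_zero abs_less_iff)
    moreover have "t n * (e / 4) \<le> f (t n *\<^sub>R a n)"
    proof -
      \<comment> \<open>\<open>infdist\<close> is an infimum of distances only for a nonempty set,
        being 0 by default otherwise; the complement contains 0.\<close>
      have "- (\<Union>n. U n) \<noteq> {}"
        using zero_notin by blast
      moreover have "t n * (e / 4) \<le> dist (t n *\<^sub>R a n) y" if "y \<in> - (\<Union>n. U n)" for y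
        using that by (auto simp: U_def not_less)
      ultimately show ?thesis
        unfolding f_def by (metis infdist_notempty cINF_greatest)
    qed
    ultimately show False
      using t_pos[of n] by (simp add: divide_less_eq mult.commute)
  qed
  ultimately show thesis
    using lip that by blast
qed

section \<open>The characterizations of Gelfand-Phillips spaces\<close>

lemma gelfand_phillips_iff:
  "gelfand_phillips TYPE('a::banach) \<longleftrightarrow>
     (\<forall>f :: 'a \<Rightarrow> real. (\<exists>L. L-lipschitz_on UNIV f) \<longrightarrow>
        (\<forall>x. gateaux_differentiable f x \<longleftrightarrow> limited_differentiable f x))"
proof
  assume gp: "gelfand_phillips TYPE('a)"
  have "gateaux_differentiable f x \<longleftrightarrow> limited_differentiable f x"
    if lip: "\<exists>L. L-lipschitz_on UNIV f" for f :: "'a \<Rightarrow> real" and x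
  proof
    assume "gateaux_differentiable f x"
    then have "hadamard_differentiable f x"
      using lip by (auto intro: gateaux_imp_hadamard_differentiable)
    \<comment> \<open>In a Gelfand-Phillips space the limited sets form a subfamily of the
      relatively compact ones.\<close>
    then show "limited_differentiable f x"
      using gp unfolding hadamard_differentiable_def limited_differentiable_def
      by (elim beta_differentiable_mono) (auto simp: gelfand_phillips_def)
  qed (rule limited_imp_gateaux_differentiable)
  then show "\<forall>f :: 'a \<Rightarrow> real. (\<exists>L. L-lipschitz_on UNIV f) \<longrightarrow>
      (\<forall>x. gateaux_differentiable f x \<longleftrightarrow> limited_differentiable f x)"
    by blast
next
  assume coincide: "\<forall>f :: 'a \<Rightarrow> real. (\<exists>L. L-lipschitz_on UNIV f) \<longrightarrow>
      (\<forall>x. gateaux_differentiable f x \<longleftrightarrow> limited_differentiable f x)"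
  show "gelfand_phillips TYPE('a)"
    unfolding gelfand_phillips_def
  proof (intro allI impI, rule ccontr)
    fix A :: "'a set" assume "limited_set A" "\<not> compact (closure A)"
    then obtain f :: "'a \<Rightarrow> real" where "1-lipschitz_on UNIV f" "gateaux_differentiable f 0"
        "\<not> limited_differentiable f 0"
      by (rule gateaux_not_limited_differentiable)
    then show False
      using coincide by blast
  qed
qed

theorem corollary6p5:
  shows "(gelfand_phillips TYPE('a::banach) \<longleftrightarrow>
           (\<forall>f :: 'a \<Rightarrow> real. (\<exists>L. L-lipschitz_on UNIV f) \<longrightarrow>
              (\<forall>x. gateaux_differentiable f x \<longleftrightarrow> limited_differentiable f x))) \<and>
         (gelfand_phillips TYPE('a) \<longleftrightarrow>
           (\<forall>f :: 'a \<Rightarrow> real. (\<exists>L. L-lipschitz_on UNIV f) \<longrightarrow>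
              (\<forall>x. hadamard_differentiable f x \<longleftrightarrow> limited_differentiable f x)))"
proof -
  have "hadamard_differentiable f x \<longleftrightarrow> gateaux_differentiable f x"
    if "\<exists>L. L-lipschitz_on UNIV f" for f :: "'a \<Rightarrow> real" and x
    using that gateaux_imp_hadamard_differentiable hadamard_imp_gateaux_differentiable by blast
  then show ?thesis
    using gelfand_phillips_iff[where 'a = 'a] by auto
qed

end
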